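(* Let $\mathfrak a:[-1,1]\times\mathbb R_+\to\mathbb R_+$ be a continuous function. 1. Suppose that for some $F\in\mathfrak F$ the inequality $I(\mathfrak a,u^* )\le I(\mathfrak a,u)$ holds for every non-negative piecewise linear function $u$ on $[-1,1]$. Then $\mathfrak a$ is even with respect to the first argument, that is, $\mathfrak a(x,v)=\mathfrak a(-x,v)$ for all $x\in[-1,1]$, $v\in\mathbb R_+$. 2. Suppose that for every $F\in\mathfrak F$ the inequality $I(\mathfrak a,u^* )\le I(\mathfrak a,u)$ holds for every non-negative piecewise linear function $u$ on $[-1,1]$. Then $$\mathfrak a(s,v)+\mathfrak a(t,v)\ge \mathfrak a(1-t+s,v)\qquad\text{for all } -1\le s\le t\le 1,\ v\in\mathbb R_+ .$$
   Context: $\mathbb R_+=[0,\infty)$. $\mathfrak F$ is the set of continuous functions $F:\mathbb R_+\times\mathbb R_+\to\mathbb R_+$ that are convex and increasing with respect to the second argument. Piecewise linear functions are continuous with finitely many linear pieces. For $F\in\mathfrak F$, a continuous weight $\mathfrak a:[-1,1]\times\mathbb R_+\to\mathbb R_+$ and a non-negative $u\in W_1^1(-1,1)$ (the Sobolev space of absolutely continuous functions on $[-1,1]$), $$I(\mathfrak a,u)=\int_{-1}^1 F\big(u(x),\mathfrak a(x,u(x))\,|u'(x)|\big)\,dx.$$ The monotone rearrangement of a measurable set $E\subset[-1,1]$ is $E^*=[1-|E|,1]$, where $|E|$ is the Lebesgue measure of $E$ (with $\emptyset^*=\emptyset$). For non-negative $u\in W_1^1(-1,1)$, with $\mathcal A_t=\{x\in[-1,1]:u(x)>t\}$,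 the monotone rearrangement of $u$ is $u^*(x)=\int_0^\infty\chi_{\mathcal A_t^*}(x)\,dt$. *)

theory Defs
  imports "HOL-Analysis.Analysis"
begin

text \<open>
  Functions on \<open>[-1,1]\<close> and on \<open>[0,\<infinity>)\<close> are represented by total functions on the reals;
  values outside these domains are never constrained, and never used except on null sets.

  In the class of integrands \<open>F\<close>, ``increasing'' means strictly increasing: with a merely
  nondecreasing \<open>F\<close>, such as \<open>F = 0\<close>, the functional may carry no information about the weight.
\<close>

definition integrands :: "(real \<Rightarrow> real \<Rightarrow> real) set" where
  "integrands = {F.
     continuous_on ({0..} \<times> {0..}) (\<lambda>(v, p). F v p) \<and>
     (\<forall>v\<ge>0. \<forall>p\<ge>0. 0 \<le> F v p) \<and>
     (\<forall>v\<ge>0. convex_on {0..} (F v)) \<and>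
     (\<forall>v\<ge>0. strict_mono_on {0..} (F v))}"

definition piecewise_linear :: "(real \<Rightarrow> real) \<Rightarrow> bool" where
  "piecewise_linear u \<longleftrightarrow>
     continuous_on {-1..1} u \<and>
     (\<exists>(n::nat) p. p 0 = -1 \<and> p n = 1 \<and>
        (\<forall>i<n. p i < p (Suc i) \<and>
           (\<exists>c d. \<forall>x\<in>{p i<..<p (Suc i)}. u x = c * x + d)))"

definition set_rearr :: "real set \<Rightarrow> real set" where
  "set_rearr E = (if E = {} then {} else {1 - measure lebesgue E..1})"

definition mono_rearr :: "(real \<Rightarrow> real) \<Rightarrow> real \<Rightarrow> real" where
  "mono_rearr u x =
     (LINT t:{0..}|lborel. indicat_real (set_rearr {y \<in> {-1..1}. u y > t}) x)"

text \<open>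
  The integrand is non-negative, so the functional takes values in \<open>[0,\<infinity>]\<close>. An absolutely
  continuous \<open>u\<close> is differentiable almost everywhere, with \<open>deriv u\<close> its weak derivative; the
  unspecified values of \<open>deriv u\<close> on the exceptional null set are irrelevant, because the
  Lebesgue measure is complete.
\<close>

definition functional ::
    "(real \<Rightarrow> real \<Rightarrow> real) \<Rightarrow> (real \<Rightarrow> real \<Rightarrow> real) \<Rightarrow> (real \<Rightarrow> real) \<Rightarrow> ennreal" where
  "functional F a u =
     (\<integral>\<^sup>+x\<in>{-1..1}. ennreal (F (u x) (a x (u x) * \<bar>deriv u x\<bar>)) \<partial>lebesgue)"

end

theory Submission imports Defs begin

text \<open>
  Both parts test the inequality on a profile that equals a constant \<open>v\<close> up to a tiny excursion
  of height \<open>d\<close> with slopes \<open>\<plusminus>1\<close>, placed where the weight is to be sampled. Where such a profile is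
  flat, the integrand does not see the weight; where it is sloped, the integrand is close to
  \<open>F v (a x v)\<close> at the point \<open>x\<close> to be sampled, because \<open>F\<close> and \<open>a\<close> are continuous.

  For the evenness, the profile descends from \<open>v + d\<close> to \<open>v\<close> near \<open>s\<close>. Its rearrangement is its
  mirror image, which ascends near \<open>-s\<close>. The flat parts of the two contribute equally, so the
  inequality compares \<open>F v (a (-s) v)\<close> with \<open>F v (a s v)\<close>, and strict monotonicity of \<open>F v\<close> gives
  \<open>a (-s) v \<le> a s v\<close> (\<open>weight_reflection_le\<close>). Exchanging \<open>s\<close> and \<open>-s\<close> gives equality.

  For the second inequality take \<open>F v p = p\<close>. The profile is a trapezoid that ascends
  near \<open>s\<close> and descends near \<open>t\<close>. At each level strictly between \<open>v\<close> and \<open>v + d\<close>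
  its superlevel set is an interval of length about \<open>t - s\<close>, so its rearrangement ascends near
  \<open>1 - t + s\<close>; it does so with slope \<open>1/2\<close> over a length \<open>2 * d\<close>, since both ends of the interval
  move as the level changes. The functional is thus about \<open>(a s v + a t v) * d\<close> for the profile
  and \<open>a (1 - t + s) v * d\<close> for the rearrangement (\<open>weight_triangle\<close>).

  Both arguments run by contradiction: if the claim fails at some points, it fails with a margin
  on whole neighbourhoods of them. This replaces a passage to the limit \<open>d \<rightarrow> 0\<close>, it reduces the
  estimates of the functional to comparisons with step functions, and it leaves room to move the
  slopes into the open interval when \<open>s\<close> or \<open>t\<close> is an endpoint.
\<close>

section \<open>Computing the monotone rearrangement\<close>

text \<open>
  The layer-cake integral over levels \<open>t\<close> recovers \<open>w x\<close>: since \<open>w\<close> is increasing, the superlevel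
  set at a level below \<open>w x\<close> contains \<open>[x, 1]\<close>, and at a level above \<open>w x\<close> continuity keeps it a
  positive distance to the right of \<open>x\<close>. The endpoint \<open>x = 1\<close> would need a separate treatment, as
  \<open>[1, 1]\<close> has measure zero; for the functional it is irrelevant.
\<close>

lemma mono_rearr_eqI:
  fixes u w :: "real \<Rightarrow> real"
  assumes cont: "continuous_on {-1..1} w" and mono: "mono_on {-1..1} w"
    and nonneg: "\<And>x. x \<in> {-1..1} \<Longrightarrow> 0 \<le> w x"
    and eqm: "\<And>t. 0 \<le> t \<Longrightarrow>
      measure lebesgue {y \<in> {-1..1}. u y > t} = measure lebesgue {y \<in> {-1..1}. w y > t}"
    and x: "x \<in> {-1<..<1}"
  shows "mono_rearr u x = w x"
proof -
  have meas: "{y \<in> {-1..1}. w y > t} \<in> lmeasurable" for t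
  proof -
    have "closed ({-1..1} \<inter> w -` {..t})"
      using continuous_closed_preimage[OF cont] by auto
    then have "{-1..1} \<inter> w -` {..t} \<in> lmeasurable"
      by (intro lmeasurable_compact)
        (auto simp: compact_eq_bounded_closed intro: bounded_subset[OF bounded_closed_interval])
    then have "{-1..1} - ({-1..1} \<inter> w -` {..t}) \<in> lmeasurable"
      using fmeasurable.Diff by blast
    moreover have "{-1..1} - ({-1..1} \<inter> w -` {..t}) = {y \<in> {-1..1}. w y > t}"
      by auto
    ultimately show ?thesis by simp
  qed
  have below: "x \<in> set_rearr {y \<in> {-1..1}. u y > t}" if t: "0 \<le> t" "t < w x" for t
  proof -
    have sub: "{x..1} \<subseteq> {y \<in> {-1..1}. w y > t}"
    proof
      fix y assume "y \<in> {x..1}"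
      then have "w x \<le> w y" "y \<in> {-1..1}" using x by (auto intro!: mono_onD[OF mono])
      then show "y \<in> {y \<in> {-1..1}. w y > t}" using t by auto
    qed
    have "1 - x = measure lebesgue {x..1}" using x by simp
    also have "\<dots> \<le> measure lebesgue {y \<in> {-1..1}. w y > t}"
      by (rule measure_mono_fmeasurable[OF sub _ meas]) simp
    finally have le: "1 - x \<le> measure lebesgue {y \<in> {-1..1}. u y > t}"
      using eqm[OF t(1)] by simp
    then have "{y \<in> {-1..1}. u y > t} \<noteq> {}" using x by (auto simp del: Collect_empty_eq)
    then show ?thesis using le x by (auto simp: set_rearr_def)
  qed
  have above: "x \<notin> set_rearr {y \<in> {-1..1}. u y > t}" if t: "0 \<le> t" "w x < t" for t
  proof -
    have "isCont w x"
      using continuous_on_interior[OF cont] x by simp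
    then have "(w \<longlongrightarrow> w x) (at x)" by (simp add: isCont_def)
    then have "\<forall>\<^sub>F y in at x. w y < t" using t order_tendstoD(2) by blast
    then obtain e where e: "e > 0" "\<And>y. y \<noteq> x \<Longrightarrow> dist y x < e \<Longrightarrow> w y < t"
      unfolding eventually_at by blast
    define e' where "e' = min e (1 - x)"
    have e': "e' > 0" "x + e' \<le> 1" using e x by (auto simp: e'_def)
    have sub: "{y \<in> {-1..1}. w y > t} \<subseteq> {x + e'..1}"
    proof
      fix y assume y: "y \<in> {y \<in> {-1..1}. w y > t}"
      have "x < y"
      proof (rule ccontr)
        assume "\<not> x < y"
        then have "w y \<le> w x" using x y by (auto intro!: mono_onD[OF mono])
        then show False using y t by auto
      qed
      moreover have "\<not> dist y x < e" using e(2)[of y] y \<open>x < y\<close> by auto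
      ultimately show "y \<in> {x + e'..1}" using y by (auto simp: dist_real_def e'_def)
    qed
    have "measure lebesgue {y \<in> {-1..1}. w y > t} \<le> measure lebesgue {x + e'..1}"
      by (rule measure_mono_fmeasurable[OF sub]) (use meas in \<open>auto intro: fmeasurableD\<close>)
    then have "measure lebesgue {y \<in> {-1..1}. u y > t} \<le> 1 - x - e'"
      using e' eqm[OF t(1)] by simp
    then show ?thesis using e' by (auto simp: set_rearr_def)
  qed
  define g where "g t = indicat_real {0..} t *\<^sub>R indicat_real (set_rearr {y \<in> {-1..1}. u y > t}) x"
    for t
  have wx: "0 \<le> w x" using nonneg x by auto
  (* The level t = w x itself may fall on either side. *)
  have "g = indicat_real {0..<w x} \<or> g = indicat_real {0..w x}"
  proof (cases "g (w x) = 0")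
    case True
    have "g t = indicat_real {0..<w x} t" for t
      using below[of t] above[of t] True wx
      by (cases t "w x" rule: linorder_cases) (auto simp: g_def indicator_def)
    then show ?thesis by blast
  next
    case False
    have "g t = indicat_real {0..w x} t" for t
      using below[of t] above[of t] False wx
      by (cases t "w x" rule: linorder_cases) (auto simp: g_def indicator_def split: if_splits)
    then show ?thesis by blast
  qed
  then have "integral\<^sup>L lborel g = w x" using wx by auto
  moreover have "mono_rearr u x = integral\<^sup>L lborel g"
    by (simp add: mono_rearr_def set_lebesgue_integral_def g_def[abs_def])
  ultimately show ?thesis by simp
qed

section \<open>Estimating the functional by step functions\<close>

lemma AE_lebesgue_notin_finite:
  fixes N :: "real set"
  assumes "finite N"
  shows "AE x in lebesgue. x \<notin> N"
  using assms by (intro AE_not_in) (simp add: negligible_iff_null_sets[symmetric] negligible_finite)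

lemma functional_cong:
  assumes "\<And>x. x \<in> {-1<..<1} \<Longrightarrow> u x = w x"
  shows "functional F a u = functional F a w"
  unfolding functional_def
proof (rule nn_integral_cong_AE)
  show "AE x in lebesgue. ennreal (F (u x) (a x (u x) * \<bar>deriv u x\<bar>)) * indicator {- 1..1} x =
      ennreal (F (w x) (a x (w x) * \<bar>deriv w x\<bar>)) * indicator {- 1..1} x"
    using AE_lebesgue_notin_finite[OF finite.insertI[OF finite.insertI[OF finite.emptyI]], of "-1" 1]
  proof (eventually_elim; goal_cases)
    case (1 x)
    show ?case
    proof (cases "x \<in> {-1<..<1}")
      case True
      then have "\<forall>\<^sub>F y in nhds x. y \<in> {-1<..<1}"
        by (intro eventually_nhds_in_open) auto
      then have "\<forall>\<^sub>F y in nhds x. u y = w y"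
        by eventually_elim (use assms in auto)
      then have "deriv u x = deriv w x" by (intro deriv_cong_ev) auto
      then show ?thesis using assms[OF True] by simp
    next
      case False
      then show ?thesis using 1 by (auto simp: indicator_def)
    qed
  qed
qed

lemma nn_integral_step:
  fixes p c :: "nat \<Rightarrow> real"
  assumes "\<forall>i<n. p i < p (Suc i)" "\<forall>i<n. 0 \<le> c i"
  shows "(\<integral>\<^sup>+x. (\<Sum>i<n. ennreal (c i) * indicator {p i<..<p (Suc i)} x) \<partial>lebesgue)
    = ennreal (\<Sum>i<n. c i * (p (Suc i) - p i))"
proof -
  have "(\<integral>\<^sup>+x. (\<Sum>i<n. ennreal (c i) * indicator {p i<..<p (Suc i)} x) \<partial>lebesgue)
    = (\<Sum>i<n. \<integral>\<^sup>+x. ennreal (c i) * indicator {p i<..<p (Suc i)} x \<partial>lebesgue)"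
    by (intro nn_integral_sum borel_measurable_times_ennreal borel_measurable_const
        borel_measurable_indicator) auto
  also have "\<dots> = (\<Sum>i<n. ennreal (c i * (p (Suc i) - p i)))"
    using assms by (intro sum.cong) (auto simp: nn_integral_cmult_indicator ennreal_mult less_imp_le)
  also have "\<dots> = ennreal (\<Sum>i<n. c i * (p (Suc i) - p i))"
    using assms by (intro sum_ennreal) (auto intro!: mult_nonneg_nonneg simp: less_imp_le)
  finally show ?thesis .
qed

lemma breakpoints_mono:
  fixes p :: "nat \<Rightarrow> real"
  assumes "\<forall>i<n. p i < p (Suc i)" "i \<le> k" "k \<le> n"
  shows "p i \<le> p k"
  using assms(2,3)
proof (induction k rule: dec_induct)
  case (step m)
  then have "p m < p (Suc m)" using assms(1) by simp
  then show ?case using step by simp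
qed simp

lemma sum_step_eq:
  fixes p :: "nat \<Rightarrow> real" and c :: "nat \<Rightarrow> ennreal"
  assumes p: "\<forall>i<n. p i < p (Suc i)" and j: "j < n" "x \<in> {p j<..<p (Suc j)}"
  shows "(\<Sum>i<n. c i * indicator {p i<..<p (Suc i)} x) = c j"
proof -
  have "indicator {p i<..<p (Suc i)} x = (if i = j then 1 else (0::ennreal))" if "i < n" for i
    using breakpoints_mono[OF p, of "Suc i" j] breakpoints_mono[OF p, of "Suc j" i] that j
    by (cases i j rule: linorder_cases) (auto simp: indicator_def)
  then have "(\<Sum>i<n. c i * indicator {p i<..<p (Suc i)} x) = (\<Sum>i<n. if i = j then c i else 0)"
    by (intro sum.cong) auto
  then show ?thesis using j by simp
qed

lemma between_breakpoints:
  fixes p :: "nat \<Rightarrow> real"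
  assumes "p 0 \<le> x" "x \<le> p n" "x \<notin> p ` {..n}"
  shows "\<exists>i<n. x \<in> {p i<..<p (Suc i)}"
  using assms
proof (induction n)
  case (Suc n)
  show ?case
  proof (cases "x \<le> p n")
    case True
    with Suc show ?thesis by (auto simp: atMost_Suc less_Suc_eq)
  next
    case False
    moreover have "x < p (Suc n)" using Suc.prems by (force simp: order_less_le)
    ultimately show ?thesis by auto
  qed
qed auto

text \<open>
  The breakpoints, where \<open>u\<close> may fail to be differentiable and \<open>deriv u\<close> is an arbitrary value,
  form a null set, so bounds on the open pieces are enough.
\<close>

lemma functional_le_step:
  fixes p c :: "nat \<Rightarrow> real"
  assumes ends: "p 0 = -1" "p n = 1" and p: "\<forall>i<n. p i < p (Suc i)" and c: "\<forall>i<n. 0 \<le> c i"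
    and bound: "\<forall>i<n. \<forall>x\<in>{p i<..<p (Suc i)}. F (u x) (a x (u x) * \<bar>deriv u x\<bar>) \<le> c i"
  shows "functional F a u \<le> ennreal (\<Sum>i<n. c i * (p (Suc i) - p i))"
  unfolding functional_def nn_integral_step[OF p c, symmetric]
proof (rule nn_integral_mono_AE)
  show "AE x in lebesgue. ennreal (F (u x) (a x (u x) * \<bar>deriv u x\<bar>)) * indicator {-1..1} x
      \<le> (\<Sum>i<n. ennreal (c i) * indicator {p i<..<p (Suc i)} x)"
    using AE_lebesgue_notin_finite[OF finite_imageI[OF finite_atMost], of p n]
  proof (eventually_elim; goal_cases)
    case (1 x)
    show ?case
    proof (cases "x \<in> {-1..1}")
      case True
      then obtain j where j: "j < n" "x \<in> {p j<..<p (Suc j)}"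
        using between_breakpoints[of p x n] ends 1 by auto
      show ?thesis
        unfolding sum_step_eq[OF p j] using bound j True by (auto intro!: ennreal_leI)
    qed simp
  qed
qed

lemma functional_ge_step:
  fixes p c :: "nat \<Rightarrow> real"
  assumes ends: "p 0 = -1" "p n = 1" and p: "\<forall>i<n. p i < p (Suc i)" and c: "\<forall>i<n. 0 \<le> c i"
    and bound: "\<forall>i<n. \<forall>x\<in>{p i<..<p (Suc i)}. c i \<le> F (u x) (a x (u x) * \<bar>deriv u x\<bar>)"
  shows "ennreal (\<Sum>i<n. c i * (p (Suc i) - p i)) \<le> functional F a u"
  unfolding functional_def nn_integral_step[OF p c, symmetric]
proof (rule nn_integral_mono_AE)
  show "AE x in lebesgue. (\<Sum>i<n. ennreal (c i) * indicator {p i<..<p (Suc i)} x)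
      \<le> ennreal (F (u x) (a x (u x) * \<bar>deriv u x\<bar>)) * indicator {-1..1} x"
  proof (rule AE_I2)
    fix x
    show "(\<Sum>i<n. ennreal (c i) * indicator {p i<..<p (Suc i)} x)
      \<le> ennreal (F (u x) (a x (u x) * \<bar>deriv u x\<bar>)) * indicator {-1..1} x"
    proof (cases "\<exists>j<n. x \<in> {p j<..<p (Suc j)}")
      case True
      then obtain j where j: "j < n" "x \<in> {p j<..<p (Suc j)}" by auto
      then have "x \<in> {-1..1}" using breakpoints_mono[OF p, of 0 j] breakpoints_mono[OF p, of "Suc j" n] ends by auto
      then show ?thesis
        unfolding sum_step_eq[OF p j] using bound j by (auto intro!: ennreal_leI)
    next
      case False
      then have "(\<Sum>i<n. ennreal (c i) * indicator {p i<..<p (Suc i)} x) = 0"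
        by (intro sum.neutral) auto
      then show ?thesis by simp
    qed
  qed
qed

section \<open>Test profiles\<close>

definition clip :: "real \<Rightarrow> real \<Rightarrow> real" where
  "clip d y = max 0 (min d y)"

lemma clip_simps:
  "y \<le> 0 \<Longrightarrow> clip d y = 0" "0 \<le> y \<Longrightarrow> y \<le> d \<Longrightarrow> clip d y = y" "0 \<le> d \<Longrightarrow> d \<le> y \<Longrightarrow> clip d y = d"
  by (auto simp: clip_def)

lemma clip_bounds: "0 \<le> d \<Longrightarrow> 0 \<le> clip d y \<and> clip d y \<le> d"
  by (auto simp: clip_def)

lemma continuous_on_clip [continuous_intros]:
  "continuous_on S z \<Longrightarrow> continuous_on S (\<lambda>x. clip d (z x))"
  unfolding clip_def by (intro continuous_intros)

lemma mono_clip: "x \<le> y \<Longrightarrow> clip d x \<le> clip d y"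
  by (auto simp: clip_def)

lemma deriv_affine_on_open:
  fixes u :: "real \<Rightarrow> real"
  assumes "\<forall>x\<in>{l<..<r}. u x = c * x + d" "x \<in> {l<..<r}"
  shows "deriv u x = c"
proof -
  have "\<forall>\<^sub>F y in nhds x. y \<in> {l<..<r}"
    using assms by (intro eventually_nhds_in_open) auto
  then have "\<forall>\<^sub>F y in nhds x. u y = c * y + d"
    by eventually_elim (use assms in auto)
  then have "deriv u x = deriv (\<lambda>y. c * y + d) x" by (intro deriv_cong_ev) auto
  also have "\<dots> = c" by (intro DERIV_imp_deriv) (auto intro!: derivative_eq_intros)
  finally show ?thesis .
qed

lemma superlevel_clip:
  assumes "0 < d"
  shows "{y \<in> {-1..1}. v + clip d (z y) > t} =
    (if t < v then {-1..1} else if v + d \<le> t then {} else {y \<in> {-1..1}. z y > t - v})"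
  using assms by (auto simp: clip_def)

text \<open>
  Outside the levels between \<open>v\<close> and \<open>v + d\<close> the superlevel sets are everything or nothing, so only
  the measures for those levels matter. The assumption on them says that their left ends, after
  rearrangement, move linearly with the level: from \<open>b\<close> to \<open>b + d / k\<close>.
\<close>

lemma mono_rearr_clip:
  assumes d: "0 < d" and v: "0 \<le> v" and k: "0 < k" 
    and b: "-1 \<le> b" "b + d / k \<le> 1"
    and meas: "\<And>h. 0 \<le> h \<Longrightarrow> h < d \<Longrightarrow> measure lebesgue {y \<in> {-1..1}. z y > h} = 1 - b - h / k"
    and x: "x \<in> {-1<..<1}"
  shows "mono_rearr (\<lambda>y. v + clip d (z y)) x = v + clip d (k * (x - b))"
proof (rule mono_rearr_eqI[OF _ _ _ _ x])
  show "mono_on {-1..1} (\<lambda>y. v + clip d (k * (y - b)))"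
    using k by (intro mono_onI) (auto intro!: mono_clip)
  fix t :: real
  have "measure lebesgue {y \<in> {-1..1}. k * (y - b) > h} = 1 - b - h / k" if h: "0 \<le> h" "h < d" for h
  proof -
    have q: "h / k < d / k" "0 \<le> h / k" using h k by (auto simp: divide_strict_right_mono)
    have "{y \<in> {-1..1}. k * (y - b) > h} = {y \<in> {-1..1}. y > b + h / k}"
      using k by (auto simp: field_simps)
    also have "\<dots> = {b + h / k<..1}" using b q by auto
    finally show ?thesis using b q by simp
  qed
  then show "measure lebesgue {y \<in> {-1..1}. t < v + clip d (z y)} =
      measure lebesgue {y \<in> {-1..1}. t < v + clip d (k * (y - b))}"
    unfolding superlevel_clip[OF d] using meas by auto
qed (use v clip_bounds[of d] d in \<open>auto intro!: continuous_intros add_nonneg_nonneg\<close>)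

section \<open>Sampling the weight\<close>

lemma continuous_on_prod_less:
  fixes f :: "real \<Rightarrow> real \<Rightarrow> real"
  assumes f: "continuous_on (S \<times> T) (\<lambda>(x, y). f x y)" and "x0 \<in> S" "y0 \<in> T" "f x0 y0 < A"
  obtains e where "e > 0" "\<And>x y. x \<in> S \<Longrightarrow> y \<in> T \<Longrightarrow> \<bar>x - x0\<bar> < e \<Longrightarrow> \<bar>y - y0\<bar> < e \<Longrightarrow> f x y < A"
proof -
  have "(x0, y0) \<in> S \<times> T" "0 < A - f x0 y0" using assms by auto
  from f[unfolded continuous_on_iff, rule_format, OF this]
  obtain d where d: "d > 0" "\<And>q. q \<in> S \<times> T \<Longrightarrow> dist q (x0, y0) < d \<Longrightarrow>
      dist (case q of (x, y) \<Rightarrow> f x y) (f x0 y0) < A - f x0 y0"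
    by auto
  show ?thesis
  proof (rule that[of "d / 2"])
    fix x y assume *: "x \<in> S" "y \<in> T" "\<bar>x - x0\<bar> < d / 2" "\<bar>y - y0\<bar> < d / 2"
    have "dist (x, y) (x0, y0) \<le> \<bar>x - x0\<bar> + \<bar>y - y0\<bar>"
      by (simp add: dist_Pair_Pair dist_real_def sqrt_sum_squares_le_sum_abs)
    then have "dist (f x y) (f x0 y0) < A - f x0 y0" using d(2)[of "(x, y)"] * by auto
    then show "f x y < A" by (auto simp: dist_real_def)
  qed (use d in auto)
qed

lemma continuous_on_prod_greater:
  fixes f :: "real \<Rightarrow> real \<Rightarrow> real"
  assumes f: "continuous_on (S \<times> T) (\<lambda>(x, y). f x y)" and "x0 \<in> S" "y0 \<in> T" "A < f x0 y0"
  obtains e where "e > 0" "\<And>x y. x \<in> S \<Longrightarrow> y \<in> T \<Longrightarrow> \<bar>x - x0\<bar> < e \<Longrightarrow> \<bar>y - y0\<bar> < e \<Longrightarrow> A < f x y"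
proof -
  have "continuous_on (S \<times> T) (\<lambda>(x, y). - f x y)"
    using continuous_on_minus[OF f] by (simp add: case_prod_unfold)
  from continuous_on_prod_less[OF this assms(2,3), of "- A"] assms(4)
  obtain e where "e > 0"
    "\<And>x y. x \<in> S \<Longrightarrow> y \<in> T \<Longrightarrow> \<bar>x - x0\<bar> < e \<Longrightarrow> \<bar>y - y0\<bar> < e \<Longrightarrow> - f x y < - A"
    by auto
  then show thesis using that[of e] by simp
qed

lemma piecewise_linearI:
  assumes "continuous_on {-1..1} u" "p 0 = -1" "p n = 1"
    and "\<forall>i<n. p i < p (Suc i) \<and> (\<exists>c d. \<forall>x\<in>{p i<..<p (Suc i)}. u x = c * x + d)"
  shows "piecewise_linear u"
  using assms unfolding piecewise_linear_def by blast

text \<open>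
  Contracting \<open>[-1, 1]\<close> towards its midpoint makes room of width \<open>2 * d\<close> on both sides of the image
  of \<open>s\<close>, while moving points by a multiple of \<open>d\<close> only; this treats \<open>s = \<plusminus>1\<close> together with the
  interior points.
\<close>

lemma interior_shift:
  fixes d s :: real
  assumes "0 < d" "d \<le> 1 / 8" "s \<in> {-1..1}"
  shows "-1 < (1 - 4 * d) * s - 2 * d" "(1 - 4 * d) * s + 2 * d < 1"
    "\<bar>(1 - 4 * d) * s - s\<bar> \<le> 4 * d"
proof -
  have "d * s \<le> d * 1" "d * (-1) \<le> d * s"
    using assms by (intro mult_left_mono; simp)+
  moreover have "(1 - 4 * d) * s \<le> (1 - 4 * d) * 1" "(1 - 4 * d) * (-1) \<le> (1 - 4 * d) * s"
    using assms by (intro mult_left_mono; simp)+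
  ultimately show "-1 < (1 - 4 * d) * s - 2 * d" "(1 - 4 * d) * s + 2 * d < 1"
    "\<bar>(1 - 4 * d) * s - s\<bar> \<le> 4 * d"
    using assms by (auto simp: algebra_simps abs_le_iff)
qed

text \<open>
  A failure of the claim gives constants \<open>L < K\<close> such that on the slope the integrand is below \<open>L\<close>
  for the descending profile and above \<open>K\<close> for its mirror image. As the contributions of the flat
  parts agree, the rearrangement has the larger functional.
\<close>

lemma weight_reflection_le:
  fixes a :: "real \<Rightarrow> real \<Rightarrow> real"
  assumes cont: "continuous_on ({-1..1} \<times> {0..}) (\<lambda>(x, v). a x v)"
    and nonneg: "\<forall>x\<in>{-1..1}. \<forall>v\<ge>0. 0 \<le> a x v"
    and F: "F \<in> integrands"
    and ineq: "\<forall>u. piecewise_linear u \<and> (\<forall>x\<in>{-1..1}. 0 \<le> u x) \<longrightarrow>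
              functional F a (mono_rearr u) \<le> functional F a u"
    and s: "s \<in> {-1..1}" and v: "0 \<le> v"
  shows "a (- s) v \<le> a s v"
proof (rule ccontr)
  assume "\<not> a (- s) v \<le> a s v"
  then have "F v (a s v) < F v (a (- s) v)"
    using F s v nonneg by (auto simp: integrands_def intro!: strict_mono_onD[where f = "F v"])
  then obtain L K where LK: "F v (a s v) < L" "L < K" "K < F v (a (- s) v)"
    by (meson dense)
  have Fpos: "0 \<le> F z q" if "0 \<le> z" "0 \<le> q" for z q
    using F that by (auto simp: integrands_def)
  have "continuous_on ({0..} \<times> {0..}) (\<lambda>(v, p). F v p)"
    using F by (auto simp: integrands_def)
  then have contF: "continuous_on ({-1..1} \<times> {0..}) (\<lambda>(x, z). F z (a x z))"
    using continuous_on_compose2[of "{0..} \<times> {0..}" "\<lambda>(v, p). F v p" "{-1..1} \<times> {0..}"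
        "\<lambda>q. (snd q, a (fst q) (snd q))"] cont nonneg
    by (force simp: case_prod_unfold intro!: continuous_intros)
  obtain e1 where e1: "e1 > 0" "\<And>x z. x \<in> {-1..1} \<Longrightarrow> z \<in> {0..} \<Longrightarrow> \<bar>x - s\<bar> < e1 \<Longrightarrow>
      \<bar>z - v\<bar> < e1 \<Longrightarrow> F z (a x z) < L"
    using continuous_on_prod_less[OF contF, of s v L] s v LK(1) by auto
  obtain e2 where e2: "e2 > 0" "\<And>x z. x \<in> {-1..1} \<Longrightarrow> z \<in> {0..} \<Longrightarrow> \<bar>x - (- s)\<bar> < e2 \<Longrightarrow>
      \<bar>z - v\<bar> < e2 \<Longrightarrow> K < F z (a x z)"
    using continuous_on_prod_greater[OF contF, of "- s" v K] s v LK(3) by auto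
  define d where "d = min (1 / 8) (min e1 e2 / 8)"
  have d: "0 < d" "d \<le> 1 / 8" "7 * d < e1" "7 * d < e2"
    using e1(1) e2(1) by (auto simp: d_def min_def)
  define l where "l = (1 - 4 * d) * s - 2 * d"
  have l: "-1 < l" "l + d < 1" "\<bar>l - s\<bar> \<le> 6 * d"
    using interior_shift[OF d(1,2) s] d by (auto simp: l_def)
  define u where "u = (\<lambda>x. v + clip d (l + d - x))"
  define w where "w = (\<lambda>x. v + clip d (1 * (x - (- l - d))))"
  have L0: "0 \<le> L" using LK(1) Fpos[of v "a s v"] s v nonneg by fastforce
  have ranges: "v \<le> u x" "u x \<le> v + d" "v \<le> w x" "w x \<le> v + d" for x
    using clip_bounds[of d] d by (auto simp: u_def w_def)
  have rearr: "mono_rearr u x = w x" if "x \<in> {-1<..<1}" for x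
    unfolding u_def w_def
  proof (rule mono_rearr_clip[OF d(1) v _ _ _ _ that])
    fix h assume h: "0 \<le> h" "h < d"
    then have "{y \<in> {-1..1}. h < l + d - y} = {-1..<l + d - h}" using l by auto
    then show "measure lebesgue {y \<in> {-1..1}. h < l + d - y} = 1 - (- l - d) - h / 1"
      using l h by simp
  qed (use l d in auto)
  have u1: "\<forall>x\<in>{-1<..<l}. u x = 0 * x + (v + d)"
    and u2: "\<forall>x\<in>{l<..<l + d}. u x = (-1) * x + (v + l + d)"
    and u3: "\<forall>x\<in>{l + d<..<1}. u x = 0 * x + v"
    using d by (auto simp: u_def clip_simps)
  have w1: "\<forall>x\<in>{-1<..<- l - d}. w x = 0 * x + v"
    and w2: "\<forall>x\<in>{- l - d<..<- l}. w x = 1 * x + (v + l + d)"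
    and w3: "\<forall>x\<in>{- l<..<1}. w x = 0 * x + (v + d)"
    using d by (auto simp: w_def clip_simps)
  have "piecewise_linear u"
  proof (rule piecewise_linearI)
    show "\<forall>i<Suc (Suc (Suc 0)). [-1, l, l + d, 1] ! i < [-1, l, l + d, 1] ! Suc i \<and>
        (\<exists>c k. \<forall>x\<in>{[-1, l, l + d, 1] ! i<..<[-1, l, l + d, 1] ! Suc i}. u x = c * x + k)"
      unfolding All_less_Suc nth_Cons_0 nth_Cons_Suc
      by (intro conjI; (use u1 u2 u3 in blast)?) (use l d in auto)
  qed (auto simp: u_def intro!: continuous_intros)
  then have "functional F a (mono_rearr u) \<le> functional F a u"
    using ineq ranges(1) v by (meson order_trans)
  moreover have "functional F a (mono_rearr u) = functional F a w"
    using rearr by (rule functional_cong)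
  moreover have "functional F a u \<le> ennreal (\<Sum>i<Suc (Suc (Suc 0)). [F (v + d) 0, L, F v 0] ! i *
      ([-1, l, l + d, 1] ! Suc i - [-1, l, l + d, 1] ! i))"
  proof (rule functional_le_step)
    have "F (u x) (a x (u x) * \<bar>deriv u x\<bar>) \<le> F (v + d) 0" if "x \<in> {-1<..<l}" for x
      using u1 that deriv_affine_on_open[OF u1 that] by simp
    moreover have "F (u x) (a x (u x) * \<bar>deriv u x\<bar>) \<le> L" if x: "x \<in> {l<..<l + d}" for x
    proof -
      have "x \<in> {-1..1}" "u x \<in> {0..}" "\<bar>x - s\<bar> < e1" "\<bar>u x - v\<bar> < e1"
        using x ranges[of x] l d v unfolding abs_less_iff abs_le_iff by auto
      from e1(2)[OF this] show ?thesis using deriv_affine_on_open[OF u2 x] by simp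
    qed
    moreover have "F (u x) (a x (u x) * \<bar>deriv u x\<bar>) \<le> F v 0" if "x \<in> {l + d<..<1}" for x
      using u3 that deriv_affine_on_open[OF u3 that] by simp
    ultimately show "\<forall>i<Suc (Suc (Suc 0)). \<forall>x\<in>{[-1, l, l + d, 1] ! i<..<[-1, l, l + d, 1] ! Suc i}.
        F (u x) (a x (u x) * \<bar>deriv u x\<bar>) \<le> [F (v + d) 0, L, F v 0] ! i"
      by (simp add: All_less_Suc)
  qed (use l d v L0 Fpos in \<open>auto simp: All_less_Suc\<close>)
  moreover have "ennreal (\<Sum>i<Suc (Suc (Suc 0)). [F v 0, K, F (v + d) 0] ! i *
      ([-1, - l - d, - l, 1] ! Suc i - [-1, - l - d, - l, 1] ! i)) \<le> functional F a w"
  proof (rule functional_ge_step)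
    have "F v 0 \<le> F (w x) (a x (w x) * \<bar>deriv w x\<bar>)" if "x \<in> {-1<..<- l - d}" for x
      using w1 that deriv_affine_on_open[OF w1 that] by simp
    moreover have "K \<le> F (w x) (a x (w x) * \<bar>deriv w x\<bar>)" if x: "x \<in> {- l - d<..<- l}" for x
    proof -
      have "x \<in> {-1..1}" "w x \<in> {0..}" "\<bar>x - (- s)\<bar> < e2" "\<bar>w x - v\<bar> < e2"
        using x ranges[of x] l d v unfolding abs_less_iff abs_le_iff by auto
      from e2(2)[OF this] show ?thesis using deriv_affine_on_open[OF w2 x] by simp
    qed
    moreover have "F (v + d) 0 \<le> F (w x) (a x (w x) * \<bar>deriv w x\<bar>)" if "x \<in> {- l<..<1}" for x
      using w3 that deriv_affine_on_open[OF w3 that] by simp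
    ultimately show "\<forall>i<Suc (Suc (Suc 0)).
        \<forall>x\<in>{[-1, - l - d, - l, 1] ! i<..<[-1, - l - d, - l, 1] ! Suc i}.
        [F v 0, K, F (v + d) 0] ! i \<le> F (w x) (a x (w x) * \<bar>deriv w x\<bar>)"
      by (simp add: All_less_Suc)
  qed (use l d v L0 LK Fpos in \<open>auto simp: All_less_Suc\<close>)
  ultimately have le: "ennreal (F v 0 * (1 - l - d) + K * d + F (v + d) 0 * (1 + l))
      \<le> ennreal (F (v + d) 0 * (l + 1) + L * d + F v 0 * (1 - l - d))"
    by (auto simp: algebra_simps)
  have "0 \<le> F (v + d) 0 * (l + 1) + L * d + F v 0 * (1 - l - d)"
    using l d v L0 Fpos[of v 0] Fpos[of "v + d" 0] by simp
  with le have "K * d \<le> L * d" by (simp add: ennreal_le_iff algebra_simps)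
  then show False using LK d by simp
qed

lemma linear_integrand: "(\<lambda>v p. p) \<in> integrands"
  unfolding integrands_def
  by (auto simp: case_prod_unfold convex_on_def strict_mono_on_def intro!: continuous_intros)

text \<open>
  A failure of the claim gives \<open>A + B < C\<close> with \<open>a < A\<close> near \<open>(s, v)\<close>, \<open>a < B\<close> near \<open>(t, v)\<close> and
  \<open>a > C\<close> near \<open>(1 - t + s, v)\<close>. The two slopes of the trapezoid have length \<open>d\<close> each, so its
  functional is at most \<open>(A + B) * d\<close>; that of its rearrangement is at least
  \<open>(C / 2) * (2 * d) = C * d\<close>.
\<close>

lemma weight_triangle:
  fixes a :: "real \<Rightarrow> real \<Rightarrow> real"
  assumes cont: "continuous_on ({-1..1} \<times> {0..}) (\<lambda>(x, v). a x v)"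
    and nonneg: "\<forall>x\<in>{-1..1}. \<forall>v\<ge>0. 0 \<le> a x v"
    and ineq: "\<forall>u. piecewise_linear u \<and> (\<forall>x\<in>{-1..1}. 0 \<le> u x) \<longrightarrow>
              functional (\<lambda>v p. p) a (mono_rearr u) \<le> functional (\<lambda>v p. p) a u"
    and st: "-1 \<le> s" "s \<le> t" "t \<le> 1" and v: "0 \<le> v"
  shows "a (1 - t + s) v \<le> a s v + a t v"
proof (rule ccontr)
  assume "\<not> a (1 - t + s) v \<le> a s v + a t v"
  define g where "g = (a (1 - t + s) v - a s v - a t v) / 4"
  define A where "A = a s v + g"
  define B where "B = a t v + g"
  define C where "C = a (1 - t + s) v - g"
  have "g > 0" using \<open>\<not> _\<close> by (simp add: g_def)
  then have ABC: "a s v < A" "a t v < B" "C < a (1 - t + s) v" "A + B < C"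
    by (simp_all add: A_def B_def C_def) (simp add: g_def field_simps)
  have "0 \<le> a s v" "0 \<le> a t v" using nonneg st v by auto
  then have AB0: "0 \<le> A" "0 \<le> B" using ABC by linarith+
  obtain e1 where e1: "e1 > 0" "\<And>x z. x \<in> {-1..1} \<Longrightarrow> z \<in> {0..} \<Longrightarrow> \<bar>x - s\<bar> < e1 \<Longrightarrow>
      \<bar>z - v\<bar> < e1 \<Longrightarrow> a x z < A"
    using continuous_on_prod_less[OF cont, of s v A] st v ABC by auto
  obtain e2 where e2: "e2 > 0" "\<And>x z. x \<in> {-1..1} \<Longrightarrow> z \<in> {0..} \<Longrightarrow> \<bar>x - t\<bar> < e2 \<Longrightarrow>
      \<bar>z - v\<bar> < e2 \<Longrightarrow> a x z < B"
    using continuous_on_prod_less[OF cont, of t v B] st v ABC by auto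
  obtain e3 where e3: "e3 > 0" "\<And>x z. x \<in> {-1..1} \<Longrightarrow> z \<in> {0..} \<Longrightarrow> \<bar>x - (1 - t + s)\<bar> < e3 \<Longrightarrow>
      \<bar>z - v\<bar> < e3 \<Longrightarrow> C < a x z"
    using continuous_on_prod_greater[OF cont, of "1 - t + s" v C] st v ABC by auto
  (* The slopes of the trapezoid lie within 7 d of s and t; that of the rearrangement, whose foot b
     inherits the displacement of both ends, lies within 14 d of 1 - t + s. *)
  define d where "d = min (1 / 8) (min e1 (min e2 e3) / 15)"
  have d: "0 < d" "d \<le> 1 / 8" "14 * d < e1" "14 * d < e2" "14 * d < e3"
    using e1(1) e2(1) e3(1) by (auto simp: d_def min_def)
  define l where "l = (1 - 4 * d) * s - 2 * d"
  (* Shifting the feet outwards by 2 d each keeps a plateau between the slopes even when s = t. *)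
  define r where "r = (1 - 4 * d) * t + 2 * d"
  have "(1 - 4 * d) * s \<le> (1 - 4 * d) * t" using st d by (intro mult_left_mono) auto
  then have lr: "-1 < l" "r < 1" "\<bar>l - s\<bar> \<le> 6 * d" "\<bar>r - t\<bar> \<le> 6 * d" "l + 4 * d \<le> r"
    using interior_shift[OF d(1,2), of s] interior_shift[OF d(1,2), of t] st d
    by (auto simp: l_def r_def)
  define u where "u = (\<lambda>x. v + clip d (min (x - l) (r - x)))"
  define b where "b = 1 - (r - l)"
  define w where "w = (\<lambda>x. v + clip d (1 / 2 * (x - b)))"
  have b: "-1 < b" "b + 2 * d < 1" "\<bar>b - (1 - t + s)\<bar> \<le> 12 * d" using lr d by (auto simp: b_def)
  have ranges: "v \<le> u x" "u x \<le> v + d" "v \<le> w x" "w x \<le> v + d" for x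
    using clip_bounds[of d] d by (auto simp: u_def w_def)
  have rearr: "mono_rearr u x = w x" if "x \<in> {-1<..<1}" for x
    unfolding u_def w_def
  proof (rule mono_rearr_clip[OF d(1) v _ _ _ _ that])
    fix h assume h: "0 \<le> h" "h < d"
    then have "{y \<in> {-1..1}. h < min (y - l) (r - y)} = {l + h<..<r - h}"
      using lr by auto
    then show "measure lebesgue {y \<in> {-1..1}. h < min (y - l) (r - y)} =
        1 - b - h / (1 / 2)"
      using lr h by (simp add: b_def)
  qed (use b d in auto)
  have u1: "\<forall>x\<in>{-1<..<l}. u x = 0 * x + v"
    and u2: "\<forall>x\<in>{l<..<l + d}. u x = 1 * x + (v - l)"
    and u3: "\<forall>x\<in>{l + d<..<r - d}. u x = 0 * x + (v + d)"
    and u4: "\<forall>x\<in>{r - d<..<r}. u x = (-1) * x + (v + r)"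
    and u5: "\<forall>x\<in>{r<..<1}. u x = 0 * x + v"
    using d lr by (simp_all add: u_def clip_def min_def)
  have w2: "\<forall>x\<in>{b<..<b + 2 * d}. w x = 1 / 2 * x + (v - b / 2)"
    using d by (auto simp: w_def clip_simps field_simps)
  let ?p = "\<lambda>i. [-1, l, l + d, r - d, r, 1] ! i"
  let ?n = "Suc (Suc (Suc (Suc (Suc 0))))"
  have "piecewise_linear u"
  proof (rule piecewise_linearI)
    show "\<forall>i<?n. ?p i < ?p (Suc i) \<and> (\<exists>c k. \<forall>x\<in>{?p i<..<?p (Suc i)}. u x = c * x + k)"
      unfolding All_less_Suc nth_Cons_0 nth_Cons_Suc
      by (intro conjI; (use u1 u2 u3 u4 u5 in blast)?) (use lr d in auto)
  qed (auto simp: u_def intro!: continuous_intros)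
  then have "functional (\<lambda>v p. p) a (mono_rearr u) \<le> functional (\<lambda>v p. p) a u"
    using ineq ranges(1) v by (meson order_trans)
  moreover have "functional (\<lambda>v p. p) a (mono_rearr u) = functional (\<lambda>v p. p) a w"
    using rearr by (rule functional_cong)
  moreover have "functional (\<lambda>v p. p) a u \<le>
      ennreal (\<Sum>i<?n. [0, A, 0, B, 0] ! i * (?p (Suc i) - ?p i))"
  proof (rule functional_le_step)
    have "a x (u x) * \<bar>deriv u x\<bar> \<le> 0" if "x \<in> {-1<..<l}" for x
      using deriv_affine_on_open[OF u1 that] by simp
    moreover have "a x (u x) * \<bar>deriv u x\<bar> \<le> A" if x: "x \<in> {l<..<l + d}" for x
    proof -
      have "x \<in> {-1..1}" "u x \<in> {0..}" "\<bar>x - s\<bar> < e1" "\<bar>u x - v\<bar> < e1"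
        using x ranges[of x] lr d v unfolding abs_less_iff abs_le_iff by auto
      from e1(2)[OF this] show ?thesis using deriv_affine_on_open[OF u2 x] by simp
    qed
    moreover have "a x (u x) * \<bar>deriv u x\<bar> \<le> 0" if "x \<in> {l + d<..<r - d}" for x
      using deriv_affine_on_open[OF u3 that] by simp
    moreover have "a x (u x) * \<bar>deriv u x\<bar> \<le> B" if x: "x \<in> {r - d<..<r}" for x
    proof -
      have "x \<in> {-1..1}" "u x \<in> {0..}" "\<bar>x - t\<bar> < e2" "\<bar>u x - v\<bar> < e2"
        using x ranges[of x] lr d v unfolding abs_less_iff abs_le_iff by auto
      from e2(2)[OF this] show ?thesis using deriv_affine_on_open[OF u4 x] by simp
    qed
    moreover have "a x (u x) * \<bar>deriv u x\<bar> \<le> 0" if "x \<in> {r<..<1}" for x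
      using deriv_affine_on_open[OF u5 that] by simp
    ultimately show "\<forall>i<?n. \<forall>x\<in>{?p i<..<?p (Suc i)}. a x (u x) * \<bar>deriv u x\<bar> \<le> [0, A, 0, B, 0] ! i"
      by (simp add: All_less_Suc)
  qed (use lr d AB0 in \<open>auto simp: All_less_Suc\<close>)
  moreover have "ennreal (\<Sum>i<Suc (Suc (Suc 0)). [0, C / 2, 0] ! i *
      ([-1, b, b + 2 * d, 1] ! Suc i - [-1, b, b + 2 * d, 1] ! i)) \<le> functional (\<lambda>v p. p) a w"
  proof (rule functional_ge_step)
    have pos: "0 \<le> a x (w x) * \<bar>deriv w x\<bar>" if "x \<in> {-1..1}" for x
      using nonneg that ranges(3)[of x] v by (intro mult_nonneg_nonneg) auto
    have "C / 2 \<le> a x (w x) * \<bar>deriv w x\<bar>" if x: "x \<in> {b<..<b + 2 * d}" for x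
    proof -
      have "x \<in> {-1..1}" "w x \<in> {0..}" "\<bar>x - (1 - t + s)\<bar> < e3" "\<bar>w x - v\<bar> < e3"
        using x ranges[of x] b d v unfolding abs_less_iff abs_le_iff by auto
      from e3(2)[OF this] show ?thesis
        unfolding deriv_affine_on_open[OF w2 x] by simp
    qed
    then show "\<forall>i<Suc (Suc (Suc 0)).
        \<forall>x\<in>{[-1, b, b + 2 * d, 1] ! i<..<[-1, b, b + 2 * d, 1] ! Suc i}.
        [0, C / 2, 0] ! i \<le> a x (w x) * \<bar>deriv w x\<bar>"
      using pos b d by (simp add: All_less_Suc)
  qed (use b d AB0 ABC in \<open>auto simp: All_less_Suc\<close>)
  ultimately have le: "ennreal (C * d) \<le> ennreal ((A + B) * d)"
    by (auto simp: algebra_simps)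
  have "0 \<le> (A + B) * d" using d AB0 by simp
  with le have "C * d \<le> (A + B) * d" by (simp add: ennreal_le_iff)
  then show False using ABC d by simp
qed

theorem theorem1:
  fixes a :: "real \<Rightarrow> real \<Rightarrow> real"
  assumes "continuous_on ({-1..1} \<times> {0..}) (\<lambda>(x, v). a x v)"
    and "\<forall>x\<in>{-1..1}. \<forall>v\<ge>0. 0 \<le> a x v"
  shows "((\<exists>F\<in>integrands. \<forall>u. piecewise_linear u \<and> (\<forall>x\<in>{-1..1}. 0 \<le> u x) \<longrightarrow>
              functional F a (mono_rearr u) \<le> functional F a u) \<longrightarrow>
            (\<forall>x\<in>{-1..1}. \<forall>v\<ge>0. a x v = a (- x) v)) \<and>
         ((\<forall>F\<in>integrands. \<forall>u. piecewise_linear u \<and> (\<forall>x\<in>{-1..1}. 0 \<le> u x) \<longrightarrow>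
              functional F a (mono_rearr u) \<le> functional F a u) \<longrightarrow>
            (\<forall>s t v. -1 \<le> s \<and> s \<le> t \<and> t \<le> 1 \<and> 0 \<le> v \<longrightarrow>
              a s v + a t v \<ge> a (1 - t + s) v))"
proof (intro conjI impI)
  assume "\<exists>F\<in>integrands. \<forall>u. piecewise_linear u \<and> (\<forall>x\<in>{-1..1}. 0 \<le> u x) \<longrightarrow>
              functional F a (mono_rearr u) \<le> functional F a u"
  then obtain F where F: "F \<in> integrands" "\<forall>u. piecewise_linear u \<and> (\<forall>x\<in>{-1..1}. 0 \<le> u x) \<longrightarrow>
              functional F a (mono_rearr u) \<le> functional F a u"
    by blast
  note le = weight_reflection_le[OF assms F]
  show "\<forall>x\<in>{-1..1}. \<forall>v\<ge>0. a x v = a (- x) v"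
  proof (intro ballI allI impI)
    fix x v :: real assume "x \<in> {-1..1}" "0 \<le> v"
    then show "a x v = a (- x) v" using le[of x v] le[of "- x" v] by auto
  qed
next
  assume "\<forall>F\<in>integrands. \<forall>u. piecewise_linear u \<and> (\<forall>x\<in>{-1..1}. 0 \<le> u x) \<longrightarrow>
              functional F a (mono_rearr u) \<le> functional F a u"
  from bspec[OF this linear_integrand]
  show "\<forall>s t v. -1 \<le> s \<and> s \<le> t \<and> t \<le> 1 \<and> 0 \<le> v \<longrightarrow> a s v + a t v \<ge> a (1 - t + s) v"
    using weight_triangle[OF assms] by blast
qed

end
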